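(* Let $\Omega=\{1,\dots,n\}$ with its usual total order. (i) Let $L$ and $\widehat L$ be Siegmund dual (sub-)generators on $\Omega$. If $\widehat w$ is a $k$-th order generalized eigenfunction of $\widehat L^{\mathsf T}$ associated to the eigenvalue $\lambda$, then $$u(x)=\sum_{y=x}^n\widehat w(y),\qquad x\in\Omega,$$ is a $k$-th order generalized eigenfunction of $L$ associated to the eigenvalue $\lambda$. (ii) Let $L$ and $\widehat L$ be Siegmund dual (sub-)generators on $\Omega$, and let $\{\widehat w_1,\dots,\widehat w_n\}$ be a set of (generalized) eigenfunctions of $\widehat L^{\mathsf T}$ whose span is the whole space $L^2(\Omega)$ of functions on $\Omega$. If $\{\widehat u_1,\dots,\widehat u_n\}$ are (generalized) eigenfunctions of $\widehat L$ such that $\sum_{x=1}^n\widehat w_i(x)\widehat u_j(x)=\delta_{i,j}$ for all $i,j=1,\dots,n$, and if $u_i(x)=\sum_{y=x}^n\widehat w_i(y)$ for $x\in\Omega$, $i=1,\dots,n$, then the function $$D(x,y)=\sum_{i=1}^n\widehat u_i(x)u_i(y),\qquad x,y\in\Omega,$$ is the Siegmund duality function $D_{\mathrm S}(x,y)=\mathbf 1\{x\ge y\}$. (iii) Let $L$ and $\widehat L$ be (sub-)generators on $\Omega$. If for any $k$-th order generalized eigenfunction $\widehat w$ of $\widehat L^{\mathsf T}$ associated to an eigenvalue $\lambda$, the function $u(x)=\sum_{y=x}^n\widehat w(y)$ is a $k$-th order generalized eigenfunction of $L$ associated to the same eigenvalue $\lambda$, then $L$ and $\widehat L$ are Siegmund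 dual and, for $\{\widehat w_i\}$, $\{\widehat u_i\}$ and $\{u_i\}$ chosen and related as in item (ii), $D_{\mathrm S}(x,y)=\sum_{i=1}^n\widehat u_i(x)u_i(y)$.
   Context: A generator on $\Omega$ is a real matrix $L$ with $L(x,y)\ge0$ for $x\ne y$ and zero row sums; a sub-generator is a real matrix with $L(x,y)\ge0$ for $x\neq y$ and row sums $\sum_yL(x,y)\le0$. Matrices act on functions $f:\Omega\to\mathbb{C}$ by $Lf(x)=\sum_yL(x,y)f(y)$, and $L^{\mathsf T}$ is the transpose. $L$ and $\widehat L$ are Siegmund dual if, with $D_{\mathrm S}(x,y)=\mathbf 1\{x\ge y\}$, $\sum_{z}\widehat L(x,z)D_{\mathrm S}(z,y)=\sum_zL(y,z)D_{\mathrm S}(x,z)$ for all $x,y\in\Omega$, i.e. $\widehat LD_{\mathrm S}=D_{\mathrm S}L^{\mathsf T}$, equivalently $\sum_{x'=y}^n\widehat L(x,x')=\sum_{y'=1}^xL(y,y')$ for all $x,y$. Generalized eigenfunctions are understood as members of Jordan chains: a linearly independent family $f^{(1)},\dots,f^{(m)}$ of functions with $Af^{(1)}=\lambda f^{(1)}$ and $Af^{(k)}=\lambda f^{(k)}+f^{(k-1)}$ for $1<k\le m$ is a chain for the operator $A$ and eigenvalue $\lambda\in\mathbb{C}$, and $f^{(k)}$ is its $k$-th order generalized eigenfunction. The statements in (i) and (iii) that $\widehat w\mapsto u$, $u(x)=\sum_{y\ge x}\widehat w(y)$, sends $k$-th order generalized eigenfunctions of $\widehat L^{\mathsf T}$ to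 $k$-th order generalized eigenfunctions of $L$ are understood along chains: if $\widehat w^{(1)},\dots,\widehat w^{(m)}$ is a chain for $\widehat L^{\mathsf T}$ and $\lambda$, then the corresponding $u^{(1)},\dots,u^{(m)}$ form a chain for $L$ and $\lambda$. *)

theory Defs
  imports "HOL-Analysis.Analysis"
begin

text \<open>
  The state space \<open>{1, \<dots>, n}\<close> with its usual total order is rendered as an index type
  \<open>'n :: {finite, linorder}\<close>: every such type is, in a unique way, order isomorphic to
  \<open>{1, \<dots>, n}\<close> with \<open>n = CARD('n)\<close>, and every \<open>n \<ge> 1\<close> arises.
  Functions on the state space with complex values are vectors \<open>complex ^ 'n\<close>; families of
  \<open>n\<close> functions are indexed by \<open>'n\<close> itself.
\<close>

definition generator :: "real^'n^'n \<Rightarrow> bool" where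
  "generator L \<longleftrightarrow>
     (\<forall>x y. x \<noteq> y \<longrightarrow> 0 \<le> L $ x $ y) \<and> (\<forall>x. (\<Sum>y\<in>UNIV. L $ x $ y) = 0)"

definition sub_generator :: "real^'n^'n \<Rightarrow> bool" where
  "sub_generator L \<longleftrightarrow>
     (\<forall>x y. x \<noteq> y \<longrightarrow> 0 \<le> L $ x $ y) \<and> (\<forall>x. (\<Sum>y\<in>UNIV. L $ x $ y) \<le> 0)"

lemma generator_imp_sub_generator: "generator L \<Longrightarrow> sub_generator L"
  by (simp add: generator_def sub_generator_def)

definition siegmund_function :: "real^'n::{finite,linorder}^'n::{finite,linorder}" where
  "siegmund_function = (\<chi> x y. if x \<ge> y then 1 else 0)"

definition siegmund_dual ::
    "real^'n::{finite,linorder}^'n::{finite,linorder} \<Rightarrow> real^'n::{finite,linorder}^'n::{finite,linorder} \<Rightarrow> bool" where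
  "siegmund_dual L Lh \<longleftrightarrow> Lh ** siegmund_function = siegmund_function ** transpose L"

lemma siegmund_dual_iff_entries:
  "siegmund_dual L Lh \<longleftrightarrow>
     (\<forall>x y. (\<Sum>x'\<in>{y..}. Lh $ x $ x') = (\<Sum>y'\<in>{..x}. L $ y $ y'))"
proof -
  have "(Lh ** siegmund_function) $ x $ y = (\<Sum>x'\<in>{y..}. Lh $ x $ x')" for x y
    by (simp add: matrix_matrix_mult_def siegmund_function_def if_distrib
        atLeast_def sum.If_cases cong: if_cong)
  moreover have
    "(siegmund_function ** transpose L) $ x $ y = (\<Sum>y'\<in>{..x}. L $ y $ y')" for x y
    by (simp add: matrix_matrix_mult_def siegmund_function_def transpose_def
        if_distrib[of "\<lambda>c. c * _"] atMost_def sum.If_cases cong: if_cong)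
  ultimately show ?thesis
    by (simp add: siegmund_dual_def vec_eq_iff)
qed

text \<open>The action of a real matrix on complex-valued functions is \<open>cmatrix L *v f\<close>.\<close>

abbreviation cmatrix :: "real^'n^'m \<Rightarrow> complex^'n^'m" where
  "cmatrix L \<equiv> map_matrix complex_of_real L"

text \<open>
  Chains are indexed from \<open>1\<close> to \<open>m\<close>; the values of \<open>f\<close> at other indices are irrelevant.
  Independence is that of the family, over the complex numbers, hence the injectivity clause.
\<close>

definition jordan_chain ::
    "complex^'n^'n \<Rightarrow> complex \<Rightarrow> nat \<Rightarrow> (nat \<Rightarrow> complex^'n) \<Rightarrow> bool" where
  "jordan_chain A \<mu> m f \<longleftrightarrow>
     1 \<le> m \<and> inj_on f {1..m} \<and> vec.independent (f ` {1..m}) \<and>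
     A *v f 1 = \<mu> *s f 1 \<and>
     (\<forall>k. 1 < k \<and> k \<le> m \<longrightarrow> A *v f k = \<mu> *s f k + f (k - 1))"

definition gen_eigenfunction ::
    "complex^'n^'n \<Rightarrow> complex \<Rightarrow> nat \<Rightarrow> complex^'n \<Rightarrow> bool" where
  "gen_eigenfunction A \<mu> k g \<longleftrightarrow>
     (\<exists>m f. jordan_chain A \<mu> m f \<and> 1 \<le> k \<and> k \<le> m \<and> g = f k)"

definition tail_sum :: "complex^'n::{finite,linorder} \<Rightarrow> complex^'n::{finite,linorder}" where
  "tail_sum w = (\<chi> x. \<Sum>y\<in>{x..}. w $ y)"

text \<open>
  The members of \<open>w\<close> and \<open>uh\<close> may have different eigenvalues and orders, and need not be
  arranged in complete chains. The pairing is bilinear, without complex conjugation.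
\<close>

definition biorthogonal_eigenfunctions ::
    "real^'n^'n \<Rightarrow> ('n \<Rightarrow> complex^'n) \<Rightarrow> ('n \<Rightarrow> complex^'n) \<Rightarrow> bool" where
  "biorthogonal_eigenfunctions Lh w uh \<longleftrightarrow>
     (\<forall>i. \<exists>\<mu> k. gen_eigenfunction (cmatrix (transpose Lh)) \<mu> k (w i)) \<and>
     vec.span (range w) = UNIV \<and>
     (\<forall>j. \<exists>\<mu> k. gen_eigenfunction (cmatrix Lh) \<mu> k (uh j)) \<and>
     (\<forall>i j. (\<Sum>x\<in>UNIV. w i $ x * uh j $ x) = (if i = j then 1 else 0))"

end

theory Submission
  imports Defs "HOL-Computational_Algebra.Fundamental_Theorem_Algebra"
begin

text \<open>
  Let \<open>D\<close> be the Siegmund function, as a matrix. Passing to tail sums is multiplication by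
  \<open>T = D\<^sup>T\<close>, an invertible triangular matrix, and transposing the duality relation
  turns it into \<open>L T = T Lh\<^sup>T\<close> (\<open>siegmund_dual_iff_intertwines\<close>). So duality says that \<open>T\<close>
  conjugates \<open>Lh\<^sup>T\<close> into \<open>L\<close>.

  \<^item> A conjugacy maps Jordan chains to Jordan chains; injectivity of \<open>T\<close> keeps them independent
    (\<open>jordan_chain_tail_sum\<close>).

  \<^item> Biorthogonality of two families of \<open>n\<close> vectors says that one square matrix is a left inverse of
    another, so it is also a right inverse. This gives a resolution of the identity
    \<open>\<Sum>\<^sub>i uh\<^sub>i(x) w\<^sub>i(z) = \<delta>\<^sub>x\<^sub>z\<close>, and summing over \<open>z \<ge> y\<close> gives the indicator of
    \<open>x \<ge> y\<close> (\<open>biorthogonal_expansion\<close>).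

  \<^item> Conversely, if \<open>T\<close> maps every chain of \<open>Lh\<^sup>T\<close> to a chain of \<open>L\<close>, then comparing the chain
    relations shows that \<open>L T\<close> and \<open>T Lh\<^sup>T\<close> agree on all members of chains. These span the
    space, so the two matrices are equal (\<open>siegmund_dual_if_chains\<close>).

  The substance of the converse is that members of Jordan chains of a complex matrix \<open>A\<close> span,
  which comes from the root space decomposition. Every nonzero vector \<open>v\<close> killed by a power of \<open>A - \<mu>\<close> is the top of the chain of its images under the
  powers of \<open>A - \<mu>\<close> (\<open>root_vector_in_jordan_chain\<close>), so it suffices that such vectors span
  (\<open>span_root_vectors\<close>). Each vector is annihilated by some nonzero polynomial in \<open>A\<close>, which
  splits into linear factors by the fundamental theorem of algebra; the factors are removed one
  at a time, because \<open>v\<close> lies in the span of the root vectors as soon as \<open>(A - \<nu>) v\<close> does.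
\<close>

section \<open>Iterates of a matrix\<close>

lemma linear_matrix_funpow: "Vector_Spaces.linear (*s) (*s) ((*v) (M :: 'a::field^'n^'n) ^^ k)"
proof (induction k)
  case 0
  show ?case by (simp add: id_def vec.linear_ident)
next
  case (Suc k)
  then show ?case
    using Vector_Spaces.linear_compose[OF Suc matrix_vector_mul_linear_gen[of M]] by (simp only: funpow.simps)
qed

lemmas matrix_funpow_add = vec.linear_add[OF linear_matrix_funpow]
  and matrix_funpow_diff = vec.linear_diff[OF linear_matrix_funpow]
  and matrix_funpow_scale = vec.linear_scale[OF linear_matrix_funpow]
  and matrix_funpow_0 = vec.linear_0[OF linear_matrix_funpow]

lemma matrix_funpow_eq_0_mono:
  fixes M :: "'a::field^'n^'n"
  assumes "((*v) M ^^ k) v = 0" and "k \<le> l"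
  shows "((*v) M ^^ l) v = 0"
proof -
  have "((*v) M ^^ l) v = ((*v) M ^^ (l - k)) (((*v) M ^^ k) v)"
    using assms(2) by (simp flip: funpow_add[THEN fun_cong, unfolded comp_apply])
  then show ?thesis
    by (simp add: assms(1) matrix_funpow_0)
qed

lemma mat_mult_vec: "mat c *v v = (c :: 'a::comm_ring_1) *s v"
  by (simp add: vec_eq_iff matrix_vector_mult_def mat_def if_distrib[of "\<lambda>c. c * _"] sum.delta
      cong: if_cong)

section \<open>Generalized eigenvectors span the space\<close>

definition root_vectors :: "'a::field^'n^'n \<Rightarrow> ('a^'n) set" where
  "root_vectors A = {v. \<exists>\<mu> k. ((*v) (A - mat \<mu>) ^^ k) v = 0}"

text \<open>
  For \<open>\<mu> \<noteq> \<nu>\<close> the operator \<open>A - \<nu> = (A - \<mu>) + (\<mu> - \<nu>)\<close> is a nilpotent perturbation of a nonzero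
  scalar on the kernel of \<open>(A - \<mu>)\<^sup>k\<close>, so it is onto there.
\<close>

lemma shift_solvable_in_root_space:
  fixes A :: "'a::field^'n^'n"
  assumes "((*v) (A - mat \<mu>) ^^ k) u = 0" and "\<mu> \<noteq> \<nu>"
  obtains g where "((*v) (A - mat \<mu>) ^^ k) g = 0" and "(A - mat \<nu>) *v g = u"
proof -
  have "\<exists>g. ((*v) (A - mat \<mu>) ^^ k) g = 0 \<and> (A - mat \<nu>) *v g = u"
    using assms(1)
  proof (induction k arbitrary: u)
    case 0
    then show ?case by auto
  next
    case (Suc k)
    let ?u' = "(A - mat \<mu>) *v u"
    have "((*v) (A - mat \<mu>) ^^ k) ?u' = 0"
      using Suc.prems by (simp add: funpow_swap1)
    then obtain g' where g': "((*v) (A - mat \<mu>) ^^ k) g' = 0" "(A - mat \<nu>) *v g' = ?u'"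
      using Suc.IH by blast
    \<comment> \<open>\<open>(A - \<nu>) u = (A - \<mu>) u + (\<mu> - \<nu>) u = (A - \<nu>) g' + (\<mu> - \<nu>) u\<close>, to be solved for \<open>u\<close>.\<close>
    define g where "g = (1 / (\<mu> - \<nu>)) *s (u - g')"
    have "((*v) (A - mat \<mu>) ^^ Suc k) g' = 0"
      using g'(1) by simp
    then have "((*v) (A - mat \<mu>) ^^ Suc k) g = 0"
      unfolding g_def by (simp only: matrix_funpow_scale matrix_funpow_diff Suc.prems) simp
    moreover have shift: "(A - mat \<nu>) *v (u - g') = (\<mu> - \<nu>) *s u"
      by (simp add: matrix_vector_mult_diff_distrib g'(2))
        (simp add: matrix_vector_mult_diff_rdistrib mat_mult_vec vec.scale_left_diff_distrib)
    have "(A - mat \<nu>) *v g = u"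
      unfolding g_def vector_scalar_commute shift vec.scale_scale using assms(2) by simp
    ultimately show ?case by blast
  qed
  then show ?thesis using that by blast
qed

text \<open>
  Write \<open>u\<close> as a combination of root vectors. Those for \<open>\<mu> \<noteq> \<nu>\<close> have preimages under \<open>A - \<nu>\<close>, so
  only a root vector for \<open>\<nu>\<close> itself is left over.
\<close>

lemma shift_solvable_up_to_root_vector:
  fixes A :: "'a::field^'n^'n"
  assumes "u \<in> vec.span (root_vectors A)"
  shows "\<exists>g \<in> vec.span (root_vectors A). \<exists>k.
           ((*v) (A - mat \<nu>) ^^ k) (u - (A - mat \<nu>) *v g) = 0"
  using assms
proof (induction rule: vec.span_induct_alt)
  case base
  show ?case by (intro bexI[of _ 0] exI[of _ 0]) (auto simp: vec.span_zero)
next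
  case (step c x y)
  obtain g l where g: "g \<in> vec.span (root_vectors A)"
    "((*v) (A - mat \<nu>) ^^ l) (y - (A - mat \<nu>) *v g) = 0"
    using step.IH by blast
  obtain \<mu> k where k: "((*v) (A - mat \<mu>) ^^ k) x = 0"
    using step.hyps by (auto simp: root_vectors_def)
  obtain h m where h: "h \<in> vec.span (root_vectors A)"
    "((*v) (A - mat \<nu>) ^^ m) (x - (A - mat \<nu>) *v h) = 0"
  proof (cases "\<mu> = \<nu>")
    case True
    then show ?thesis
      using k that[of 0 k] by (simp add: vec.span_zero)
  next
    case False
    from shift_solvable_in_root_space[OF k this] obtain h
      where "((*v) (A - mat \<mu>) ^^ k) h = 0" "(A - mat \<nu>) *v h = x" .
    moreover from this(1) have "h \<in> vec.span (root_vectors A)"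
      by (intro vec.span_base) (auto simp: root_vectors_def)
    ultimately show ?thesis
      using that[of h 0] by simp
  qed
  let ?n = "max l m"
  have "((*v) (A - mat \<nu>) ^^ ?n) (c *s x + y - (A - mat \<nu>) *v (c *s h + g)) =
      ((*v) (A - mat \<nu>) ^^ ?n) (c *s (x - (A - mat \<nu>) *v h) + (y - (A - mat \<nu>) *v g))"
    by (simp add: matrix_vector_right_distrib vector_scalar_commute vec.scale_right_diff_distrib
        add_diff_add)
  also have "\<dots> = 0"
    using matrix_funpow_eq_0_mono[OF g(2), of ?n] matrix_funpow_eq_0_mono[OF h(2), of ?n]
    by (simp only: matrix_funpow_add matrix_funpow_scale) simp
  finally show ?case
    using g(1) h(1) by (meson vec.span_add vec.span_scale)
qed

text \<open>
  The left-over root vector of the previous lemma is \<open>(A - \<nu>) (v - g)\<close>, so \<open>v - g\<close> is a root vector,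
  killed by one more power of \<open>A - \<nu>\<close>.
\<close>

lemma shift_preimage_in_span_root_vectors:
  fixes A :: "'a::field^'n^'n"
  assumes "(A - mat \<nu>) *v v \<in> vec.span (root_vectors A)"
  shows "v \<in> vec.span (root_vectors A)"
proof -
  obtain g k where g: "g \<in> vec.span (root_vectors A)"
    "((*v) (A - mat \<nu>) ^^ k) ((A - mat \<nu>) *v v - (A - mat \<nu>) *v g) = 0"
    using shift_solvable_up_to_root_vector[OF assms] by blast
  have "((*v) (A - mat \<nu>) ^^ Suc k) (v - g) = 0"
    using g(2) by (simp add: funpow_swap1 matrix_vector_mult_diff_distrib)
  then have "v - g \<in> vec.span (root_vectors A)"
    unfolding root_vectors_def by (intro vec.span_base) blast
  from vec.span_add[OF this g(1)] show ?thesis by simp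
qed

text \<open>
  If \<open>p(X) = (X - \<nu>) q(X)\<close> annihilates \<open>v\<close>, then \<open>q\<close> annihilates \<open>(A - \<nu>) v\<close>. The induction is on
  a bound \<open>N\<close> for the degree, which also serves as the range of summation.
\<close>

lemma annihilated_in_span_root_vectors:
  fixes A :: "complex^'n^'n"
  assumes "p \<noteq> 0" and "degree p \<le> N" and "(\<Sum>i\<le>N. coeff p i *s ((*v) A ^^ i) v) = 0"
  shows "v \<in> vec.span (root_vectors A)"
  using assms
proof (induction N arbitrary: p v)
  case 0
  then have "coeff p 0 \<noteq> 0"
    by (metis le_zero_eq leading_coeff_0_iff)
  with 0 show ?case by (simp add: vec.span_zero)
next
  case (Suc N)
  show ?case
  proof (cases "degree p = 0")
    case True
    then have "(\<Sum>i\<le>Suc N. coeff p i *s ((*v) A ^^ i) v) = coeff p 0 *s v"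
      by (subst sum.atMost_Suc_shift) (simp add: coeff_eq_0)
    moreover have "coeff p 0 \<noteq> 0"
      using Suc.prems(1) True by (metis leading_coeff_0_iff)
    ultimately show ?thesis
      using Suc.prems(3) by (simp add: vec.span_zero)
  next
    case False
    then obtain \<nu> where "poly p \<nu> = 0"
      using fundamental_theorem_of_algebra[of p] constant_degree[of p] by metis
    then obtain q where q: "p = [:-\<nu>, 1:] * q"
      by (auto simp: poly_eq_0_iff_dvd elim: dvdE)
    with Suc.prems(1) have q0: "q \<noteq> 0" by auto
    then have "degree p = Suc (degree q)"
      unfolding q by (subst degree_mult_eq) auto
    with Suc.prems(2) have dq: "degree q \<le> N" by simp
    have p_Suc: "coeff p (Suc i) = coeff q i - \<nu> * coeff q (Suc i)" for i
      by (simp add: q)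
    have p_0: "coeff p 0 = - \<nu> * coeff q 0"
      by (simp add: q)
    have "(\<Sum>i\<le>Suc N. coeff p i *s ((*v) A ^^ i) v) =
        (\<Sum>i\<le>N. coeff q i *s ((*v) A ^^ Suc i) v)
        - \<nu> *s (coeff q 0 *s v + (\<Sum>i\<le>N. coeff q (Suc i) *s ((*v) A ^^ Suc i) v))"
      unfolding sum.atMost_Suc_shift p_Suc p_0
      by (simp add: vec.scale_left_diff_distrib sum_subtractf vec.scale_sum_right
          vec.scale_right_distrib)
    also have "coeff q 0 *s v + (\<Sum>i\<le>N. coeff q (Suc i) *s ((*v) A ^^ Suc i) v) =
        (\<Sum>i\<le>Suc N. coeff q i *s ((*v) A ^^ i) v)"
      by (subst sum.atMost_Suc_shift) simp
    also have "\<dots> = (\<Sum>i\<le>N. coeff q i *s ((*v) A ^^ i) v)"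
      using dq by (simp add: coeff_eq_0)
    finally have "(\<Sum>i\<le>N. coeff q i *s ((*v) A ^^ i) ((A - mat \<nu>) *v v)) = 0"
      using Suc.prems(3)
      by (simp add: matrix_vector_mult_diff_rdistrib mat_mult_vec matrix_funpow_diff
          matrix_funpow_scale vec.scale_right_diff_distrib sum_subtractf vec.scale_sum_right
          funpow_swap1 mult.commute)
    from Suc.IH[OF q0 dq this] show ?thesis
      by (rule shift_preimage_in_span_root_vectors)
  qed
qed

text \<open>
  The \<open>n + 1\<close> vectors \<open>v, A v, \<dots>, A\<^sup>n v\<close> are linearly dependent as a family; a coincidence among
  them is a dependency too, but has to be treated apart because dependence is a property of sets.
\<close>

lemma annihilating_polynomial_exists:
  fixes A :: "'a::field^'n^'n"
  obtains p where "p \<noteq> 0" and "(\<Sum>i\<le>degree p. coeff p i *s ((*v) A ^^ i) v) = 0"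
proof -
  let ?N = "CARD('n)"
  let ?f = "\<lambda>i. ((*v) A ^^ i) v"
  have "\<exists>c. (\<exists>i\<le>?N. c i \<noteq> 0) \<and> (\<Sum>i\<le>?N. c i *s ?f i) = 0"
  proof (cases "inj_on ?f {..?N}")
    case True
    then have "card (?f ` {..?N}) = Suc ?N"
      by (simp add: card_image)
    moreover have "vec.dim (?f ` {..?N}) \<le> ?N"
      using vec.dim_subset_UNIV[of "?f ` {..?N}"] by (simp add: vec.dimension_def card_cart_basis)
    ultimately have "vec.dependent (?f ` {..?N})"
      using vec.independent_bound_general[of "?f ` {..?N}"] by linarith
    then obtain c where "\<exists>x\<in>?f ` {..?N}. c x \<noteq> 0" "(\<Sum>x\<in>?f ` {..?N}. c x *s x) = 0"
      by (subst (asm) vec.dependent_finite) auto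
    then show ?thesis
      using True by (intro exI[of _ "c \<circ> ?f"]) (auto simp: sum.reindex)
  next
    case False
    then obtain i j where ij: "i \<le> ?N" "j \<le> ?N" "i \<noteq> j" "?f i = ?f j"
      by (auto simp: inj_on_def)
    define c where "c = (\<lambda>k. if k = i then 1 else if k = j then - 1 else 0 :: 'a)"
    have "(\<Sum>k\<le>?N. c k *s ?f k) = (\<Sum>k\<in>{i, j}. c k *s ?f k)"
      using ij by (intro sum.mono_neutral_right) (auto simp: c_def)
    also have "\<dots> = 0"
      using ij by (simp add: c_def)
    finally show ?thesis
      using ij(1) by (intro exI[of _ c]) (auto simp: c_def)
  qed
  then obtain c where c: "\<exists>i\<le>?N. c i \<noteq> 0" "(\<Sum>i\<le>?N. c i *s ?f i) = 0"
    by blast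
  define p where "p = (\<Sum>i\<le>?N. monom (c i) i)"
  have coeff: "coeff p i = (if i \<le> ?N then c i else 0)" for i
    by (simp add: p_def coeff_sum)
  from c(1) have "p \<noteq> 0"
    using coeff by (metis coeff_0)
  moreover have "degree p \<le> ?N"
    by (rule degree_le) (simp add: coeff)
  then have "(\<Sum>i\<le>degree p. coeff p i *s ?f i) = (\<Sum>i\<le>?N. coeff p i *s ?f i)"
    by (intro sum.mono_neutral_left) (auto simp: coeff_eq_0)
  ultimately show ?thesis
    using that[of p] c(2) by (simp add: coeff)
qed

theorem span_root_vectors: "vec.span (root_vectors (A :: complex^'n^'n)) = UNIV"
proof -
  have "v \<in> vec.span (root_vectors A)" for v
  proof -
    obtain p where "p \<noteq> 0" "(\<Sum>i\<le>degree p. coeff p i *s ((*v) A ^^ i) v) = 0"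
      by (rule annihilating_polynomial_exists)
    then show ?thesis
      by (intro annihilated_in_span_root_vectors[of p "degree p"]) simp_all
  qed
  then show ?thesis by blast
qed

section \<open>Every generalized eigenvector belongs to a Jordan chain\<close>

text \<open>
  The \<open>k\<close>-th power of \<open>M\<close> kills \<open>f 1, \<dots>, f k\<close> but sends \<open>f (k + 1)\<close> to \<open>f 1 \<noteq> 0\<close>, so each vector
  lies outside the span of its predecessors.
\<close>

lemma nilpotent_orbit_independent:
  fixes M :: "'a::field^'n^'n"
  assumes "f 0 = 0" and "\<And>k. k < m \<Longrightarrow> M *v f (Suc k) = f k" and "1 \<le> m" and "f 1 \<noteq> 0"
  shows "inj_on f {1..m} \<and> vec.independent (f ` {1..m})"
proof -
  have pow: "((*v) M ^^ j) (f k) = f (k - j)" if "k \<le> m" "j \<le> k" for j k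
    using that
  proof (induction j)
    case (Suc j)
    then have "k - j = Suc (k - Suc j)" "k - Suc j < m" by auto
    with Suc assms(2)[of "k - Suc j"] show ?case by simp
  qed simp
  have "inj_on f {1..k} \<and> vec.independent (f ` {1..k})" if "k \<le> m" for k
    using that
  proof (induction k)
    case 0
    show ?case by (simp add: vec.independent_empty)
  next
    case (Suc k)
    have "((*v) M ^^ k) x = 0" if "x \<in> vec.span (f ` {1..k})" for x
      using that
    proof (induction rule: vec.span_induct_alt)
      case base
      show ?case by (rule matrix_funpow_0)
    next
      case (step c x y)
      then obtain i where i: "x = f i" "1 \<le> i" "i \<le> k" by auto
      with Suc.prems pow[of i i] assms(1) have "((*v) M ^^ i) x = 0" by simp
      then have "((*v) M ^^ k) x = 0"
        using i(3) by (rule matrix_funpow_eq_0_mono)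
      with step show ?case
        by (simp add: matrix_funpow_add matrix_funpow_scale)
    qed
    moreover have "((*v) M ^^ k) (f (Suc k)) \<noteq> 0"
      using pow[of "Suc k" k] Suc.prems assms(4) by simp
    ultimately have "f (Suc k) \<notin> vec.span (f ` {1..k})" by blast
    moreover from this have "f (Suc k) \<notin> f ` {1..k}"
      by (metis vec.span_base)
    moreover have "{1..Suc k} = insert (Suc k) {1..k}" by auto
    moreover have "inj_on f {1..k}" "vec.independent (f ` {1..k})"
      using Suc by auto
    ultimately show ?case
      by (simp add: vec.independent_insertI)
  qed
  then show ?thesis by blast
qed

text \<open>
  The length \<open>m\<close> of the chain is the least exponent for which \<open>(A - \<mu>)\<^sup>m\<close> kills \<open>v\<close>;
  minimality makes the first member \<open>(A - \<mu>)\<^bsup>m - 1\<^esup> v\<close> nonzero.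
\<close>

lemma root_vector_in_jordan_chain:
  fixes A :: "complex^'n^'n"
  assumes "v \<in> root_vectors A" and "v \<noteq> 0"
  obtains \<mu> m f where "jordan_chain A \<mu> m f" and "1 \<le> m" and "f m = v"
proof -
  obtain \<mu> where ex: "\<exists>k. ((*v) (A - mat \<mu>) ^^ k) v = 0"
    using assms(1) by (auto simp: root_vectors_def)
  define m where "m = (LEAST k. ((*v) (A - mat \<mu>) ^^ k) v = 0)"
  have m: "((*v) (A - mat \<mu>) ^^ m) v = 0"
    unfolding m_def using ex by (rule LeastI_ex)
  have m1: "1 \<le> m"
    using m assms(2) by (cases m) auto
  define f where "f k = ((*v) (A - mat \<mu>) ^^ (m - k)) v" for k
  have step: "(A - mat \<mu>) *v f (Suc k) = f k" if "k < m" for k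
    using that unfolding f_def by (simp flip: Suc_diff_Suc)
  have f0: "f 0 = 0"
    by (simp add: f_def m)
  have "f 1 \<noteq> 0"
    unfolding f_def using m1 by (intro not_less_Least) (simp flip: m_def)
  with nilpotent_orbit_independent[of f m, OF f0 step m1]
  have ind: "inj_on f {1..m} \<and> vec.independent (f ` {1..m})" by blast
  have "A *v f k = \<mu> *s f k + f (k - 1)" if "1 \<le> k" "k \<le> m" for k
    using step[of "k - 1"] that
    by (simp add: matrix_vector_mult_diff_rdistrib mat_mult_vec algebra_simps)
  then have "jordan_chain A \<mu> m f"
    unfolding jordan_chain_def using m1 ind f0 by auto
  moreover have "f m = v"
    by (simp add: f_def)
  ultimately show ?thesis
    using that m1 by blast
qed

lemma matrix_eq_on_jordan_chains:
  fixes A :: "complex^'n^'n" and B C :: "complex^'n^'m"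
  assumes "\<And>\<mu> m f. jordan_chain A \<mu> m f \<Longrightarrow> B *v f m = C *v f m"
  shows "B = C"
proof -
  have "B *v x = C *v x" for x
  proof (rule vec.linear_eq_on_span[of "(*v) B" "(*v) C" "root_vectors A"])
    show "B *v v = C *v v" if "v \<in> root_vectors A" for v
    proof (cases "v = 0")
      case False
      with root_vector_in_jordan_chain[OF that] assms show ?thesis by metis
    qed simp
  qed (simp_all add: span_root_vectors)
  then show ?thesis by (simp add: matrix_eq)
qed

section \<open>Tail sums and duality\<close>

lemma cmatrix_mult: "cmatrix (A ** B) = cmatrix A ** cmatrix B"
  by (simp add: vec_eq_iff matrix_matrix_mult_def)

lemma cmatrix_eq_iff: "cmatrix A = cmatrix B \<longleftrightarrow> A = B"
  by (simp add: vec_eq_iff)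

lemma tail_sum_eq_siegmund: "tail_sum w = cmatrix (transpose siegmund_function) *v w"
proof -
  have "(cmatrix (transpose siegmund_function) *v w) $ x = 
      (\<Sum>y\<in>UNIV. if x \<le> y then w $ y else 0)" for x
    unfolding matrix_vector_mult_def transpose_def siegmund_function_def
    by (auto intro!: sum.cong)
  then show ?thesis
    by (simp add: vec_eq_iff tail_sum_def atLeast_def sum.If_cases)
qed

lemma tail_sum_add: "tail_sum (v + w) = tail_sum v + tail_sum w"
  by (simp add: tail_sum_eq_siegmund matrix_vector_right_distrib)

lemma tail_sum_scale: "tail_sum (c *s w) = c *s tail_sum w"
  by (simp add: tail_sum_eq_siegmund vector_scalar_commute)

text \<open>
  A nonzero function is recovered at the last point of its support from its tail sum, since the
  tail starting there has a single nonzero term.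
\<close>

lemma tail_sum_inj: "inj tail_sum"
proof -
  have "w = 0" if w: "tail_sum w = 0" for w :: "complex^'n::{finite,linorder}"
  proof (rule ccontr)
    assume "w \<noteq> 0"
    then have ne: "{x. w $ x \<noteq> 0} \<noteq> {}" by (auto simp: vec_eq_iff)
    define x where "x = Max {x. w $ x \<noteq> 0}"
    have x: "w $ x \<noteq> 0"
      using Max_in[OF _ ne] by (simp add: x_def)
    have "w $ y = 0" if "x < y" for y
      using that Max_ge[of "{x. w $ x \<noteq> 0}" y] unfolding x_def by fastforce
    then have "(\<Sum>y\<in>{x..}. w $ y) = (\<Sum>y\<in>{x}. w $ y)"
      by (intro sum.mono_neutral_right) (auto simp: order.order_iff_strict)
    with w x show False by (simp add: tail_sum_def vec_eq_iff)
  qed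
  then show ?thesis
    unfolding tail_sum_eq_siegmund vec.linear_inj_iff_eq_0[OF matrix_vector_mul_linear_gen] by blast
qed

lemma siegmund_dual_iff_intertwines:
  "siegmund_dual L Lh \<longleftrightarrow>
     cmatrix L ** cmatrix (transpose siegmund_function) =
     cmatrix (transpose siegmund_function) ** cmatrix (transpose Lh)"
proof -
  have "siegmund_dual L Lh \<longleftrightarrow>
      transpose (Lh ** siegmund_function) = transpose (siegmund_function ** transpose L)"
    by (simp add: siegmund_dual_def transpose_iff)
  also have "\<dots> \<longleftrightarrow> L ** transpose siegmund_function = transpose siegmund_function ** transpose Lh"
    by (auto simp: matrix_transpose_mul)
  finally show ?thesis
    by (simp flip: cmatrix_mult add: cmatrix_eq_iff)
qed

lemma jordan_chain_tail_sum:
  fixes L Lh :: "real^'n::{finite,linorder}^'n::{finite,linorder}"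
  assumes "siegmund_dual L Lh" and "jordan_chain (cmatrix (transpose Lh)) \<mu> m w"
  shows "jordan_chain (cmatrix L) \<mu> m (\<lambda>k. tail_sum (w k))"
proof -
  have dual: "cmatrix L *v tail_sum v = tail_sum (cmatrix (transpose Lh) *v v)" for v
    using assms(1)
    by (simp add: siegmund_dual_iff_intertwines tail_sum_eq_siegmund matrix_vector_mul_assoc)
  have w: "inj_on w {1..m}" "vec.independent (w ` {1..m})"
    using assms(2) by (simp_all add: jordan_chain_def)
  have inj: "inj_on (tail_sum :: complex^'n::{finite,linorder} \<Rightarrow> _) S" for S
    using tail_sum_inj by (rule inj_on_subset) simp
  have "inj_on (\<lambda>k. tail_sum (w k)) {1..m}"
    using comp_inj_on[OF w(1) inj] by (simp add: comp_def)
  moreover have "vec.independent (tail_sum ` (w ` {1..m}))"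
    using w(2) inj unfolding tail_sum_eq_siegmund
    by (intro vec.linear_independent_injective_image matrix_vector_mul_linear_gen)
  ultimately show ?thesis
    using assms(2) by (simp add: jordan_chain_def dual tail_sum_add tail_sum_scale image_image)
qed

text \<open>
  Suppose \<open>Lh\<^sup>T w\<^sub>m = \<mu> w\<^sub>m + w\<^bsub>m-1\<^esub>\<close>, where \<open>w\<^sub>0\<close> stands for \<open>0\<close>. Taking tail sums gives the right-hand side of the chain
  relation for \<open>L\<close>, so \<open>L T w\<^sub>m = T Lh\<^sup>T w\<^sub>m\<close>.
\<close>

lemma siegmund_dual_if_chains:
  fixes L Lh :: "real^'n::{finite,linorder}^'n::{finite,linorder}"
  assumes "\<And>\<mu> m w. jordan_chain (cmatrix (transpose Lh)) \<mu> m w \<Longrightarrow>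
      jordan_chain (cmatrix L) \<mu> m (\<lambda>k. tail_sum (w k))"
  shows "siegmund_dual L Lh"
  unfolding siegmund_dual_iff_intertwines
proof (rule matrix_eq_on_jordan_chains)
  fix \<mu> m w
  assume w: "jordan_chain (cmatrix (transpose Lh)) \<mu> m w"
  have "1 \<le> m" using w by (simp add: jordan_chain_def)
  then have "cmatrix L *v tail_sum (w m) = tail_sum (cmatrix (transpose Lh) *v w m)"
    using w assms[OF w] by (cases "m = 1") (auto simp: jordan_chain_def tail_sum_add tail_sum_scale)
  then show "(cmatrix L ** cmatrix (transpose siegmund_function)) *v w m =
      (cmatrix (transpose siegmund_function) ** cmatrix (transpose Lh)) *v w m"
    by (simp add: tail_sum_eq_siegmund matrix_vector_mul_assoc)
qed

lemma biorthogonal_expansion: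
  fixes w uh :: "'n::{finite,linorder} \<Rightarrow> complex^'n::{finite,linorder}"
  assumes "\<And>i j. (\<Sum>x\<in>UNIV. w i $ x * uh j $ x) = (if i = j then 1 else 0)"
  shows "(\<Sum>i\<in>UNIV. uh i $ x * tail_sum (w i) $ y) = complex_of_real (siegmund_function $ x $ y)"
proof -
  define W U :: "complex^'n::{finite,linorder}^'n::{finite,linorder}" where "W = (\<chi> i x. w i $ x)" and "U = (\<chi> x j. uh j $ x)"
  have "W ** U = mat 1"
    by (simp add: W_def U_def matrix_matrix_mult_def mat_def vec_eq_iff assms)
  then have "U ** W = mat 1"
    by (simp add: matrix_left_right_inverse)
  then have resolution: "(\<Sum>i\<in>UNIV. uh i $ x * w i $ z) = (if x = z then 1 else 0)" for z
    by (simp add: W_def U_def matrix_matrix_mult_def mat_def vec_eq_iff)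
  have "(\<Sum>i\<in>UNIV. uh i $ x * tail_sum (w i) $ y) =
      (\<Sum>z\<in>{y..}. \<Sum>i\<in>UNIV. uh i $ x * w i $ z)"
    by (simp add: tail_sum_def sum_distrib_left) (rule sum.swap)
  then show ?thesis
    by (simp add: resolution siegmund_function_def)
qed

theorem theorem6p1:
  fixes L Lh :: "real^'n::{finite,linorder}^'n::{finite,linorder}"
  assumes "sub_generator L" and "sub_generator Lh"
  shows
    "(siegmund_dual L Lh \<longrightarrow>
       (\<forall>\<mu> m w. jordan_chain (cmatrix (transpose Lh)) \<mu> m w \<longrightarrow>
          jordan_chain (cmatrix L) \<mu> m (\<lambda>k. tail_sum (w k)))) \<and>
     (siegmund_dual L Lh \<longrightarrow>
       (\<forall>w uh u. biorthogonal_eigenfunctions Lh w uh \<and> (\<forall>i. u i = tail_sum (w i)) \<longrightarrow>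
          (\<forall>x y. (\<Sum>i\<in>UNIV. uh i $ x * u i $ y) =
             complex_of_real (siegmund_function $ x $ y)))) \<and>
     ((\<forall>\<mu> m w. jordan_chain (cmatrix (transpose Lh)) \<mu> m w \<longrightarrow>
          jordan_chain (cmatrix L) \<mu> m (\<lambda>k. tail_sum (w k))) \<longrightarrow>
       siegmund_dual L Lh \<and>
       (\<forall>w uh u. biorthogonal_eigenfunctions Lh w uh \<and> (\<forall>i. u i = tail_sum (w i)) \<longrightarrow>
          (\<forall>x y. (\<Sum>i\<in>UNIV. uh i $ x * u i $ y) =
             complex_of_real (siegmund_function $ x $ y))))"
proof -
  have expansion: "(\<Sum>i\<in>UNIV. uh i $ x * u i $ y) = complex_of_real (siegmund_function $ x $ y)"
    if "biorthogonal_eigenfunctions Lh w uh \<and> (\<forall>i. u i = tail_sum (w i))" for w uh u x y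
    using that biorthogonal_expansion[of w uh] by (simp add: biorthogonal_eigenfunctions_def)
  show ?thesis
    using jordan_chain_tail_sum siegmund_dual_if_chains expansion by blast
qed

end
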